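(* Let $v$ be a valuation on a division ring $D$ such that $\overline{D}=\overline{Z(D)}$, the value group is abelian and $2$-divisible, and the residue field is formally real. Suppose the value group of $v$ is of rational rank $2$ and suppose there are $x,y\in D\setminus\{0\}$ such that $v(x)$ and $v(y)$ are rationally independent and $v(xy-yx)>v(xy)$. Then $v$ is strongly abelian, i.e. $v(ab-ba)>v(ab)$ for all nonzero $a,b\in D$.
   Context: A valuation on a division ring $D$ is a map $v:D\to\Gamma\cup\{\infty\}$, with $\Gamma$ an additively written totally ordered group and $\infty>\gamma$ for all $\gamma\in\Gamma$, such that $v(a)=\infty\iff a=0$, $v(ab)=v(a)+v(b)$ and $v(a+b)\ge\min\{v(a),v(b)\}$; the value group is $v(D\setminus\{0\})$. Put $\mathcal{O}_v=\{a\in D: v(a)\ge 0\}$ and $\mathcal{M}_v=\{a\in D: v(a)>0\}$; $\overline{D}=\mathcal{O}_v/\mathcal{M}_v$ is the residue division ring. $Z(D)$ is the center of $D$, and $\overline{Z(D)}$ is the image of $Z(D)\cap\mathcal{O}_v$ in $\overline{D}$ (so the hypothesis $\overline{D}=\overline{Z(D)}$ makes $\overline{D}$ a field). *)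

theory Defs
  imports
    "HOL-Algebra.QuotRing"
    "HOL-Library.Lattice_Constructions"
    "HOL-Library.Extended_Nat"
begin

text \<open>
  Totally ordered groups, written additively but not assumed to be commutative (the library's
  \<open>linordered_ab_group_add\<close> is the commutative case).
\<close>

class linordered_group_add = group_add + linorder +
  assumes linordered_group_add_left_mono: "a \<le> b \<Longrightarrow> c + a \<le> c + b"
    and linordered_group_add_right_mono: "a \<le> b \<Longrightarrow> a + c \<le> b + c"

text \<open>
  For an ordered group \<open>\<Gamma>\<close>, the type \<open>\<Gamma> top\<close> is \<open>\<Gamma> \<union> {\<infinity>}\<close>, with \<open>top.Top\<close> playing the role
  of \<open>\<infinity>\<close>; it absorbs under addition. The constructors are qualified because a later datatype of
  the library reuses their names.
\<close>

instantiation top :: (monoid_add) monoid_add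
begin

definition zero_top :: "'a top" where
  "0 = top.Value 0"

definition plus_top :: "'a top \<Rightarrow> 'a top \<Rightarrow> 'a top" where
  "x + y =
    (case x of
      top.Top \<Rightarrow> top.Top
    | top.Value a \<Rightarrow> (case y of top.Top \<Rightarrow> top.Top | top.Value b \<Rightarrow> top.Value (a + b)))"

instance
  by standard (auto simp: zero_top_def plus_top_def add.assoc split: top.splits)

end

definition valuation :: "('d::division_ring \<Rightarrow> 'g::linordered_group_add top) \<Rightarrow> bool" where
  "valuation v \<longleftrightarrow>
    (\<forall>a. v a = top.Top \<longleftrightarrow> a = 0) \<and>
    (\<forall>a b. v (a * b) = v a + v b) \<and>
    (\<forall>a b. v (a + b) \<ge> min (v a) (v b))"

text \<open>
  The value group, as a (multiplicatively denoted) \<^type>\<open>monoid\<close> record whose product is the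
  addition of \<open>\<Gamma>\<close>; in particular \<open>\<gamma> [^] k\<close> in this record stands for \<open>k \<gamma>\<close>.
\<close>

definition value_group ::
    "('d::division_ring \<Rightarrow> 'g::linordered_group_add top) \<Rightarrow> 'g top monoid" where
  "value_group v = \<lparr>carrier = v ` (UNIV - {0}), mult = (+), one = 0\<rparr>"

definition valuation_ring ::
    "('d::division_ring \<Rightarrow> 'g::linordered_group_add top) \<Rightarrow> 'd ring" where
  "valuation_ring v =
    \<lparr>carrier = {a. v a \<ge> 0}, mult = (*), one = 1, zero = 0, add = (+)\<rparr>"

definition valuation_ideal ::
    "('d::division_ring \<Rightarrow> 'g::linordered_group_add top) \<Rightarrow> 'd set" where
  "valuation_ideal v = {a. v a > 0}"

definition residue_ring ::
    "('d::division_ring \<Rightarrow> 'g::linordered_group_add top) \<Rightarrow> 'd set ring" where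
  "residue_ring v = valuation_ring v Quot valuation_ideal v"

definition ring_center :: "'d::division_ring set" where
  "ring_center = {z. \<forall>a. z * a = a * z}"

definition residue_of_center ::
    "('d::division_ring \<Rightarrow> 'g::linordered_group_add top) \<Rightarrow> 'd set set" where
  "residue_of_center v =
    (\<lambda>z. valuation_ideal v +>\<^bsub>valuation_ring v\<^esub> z) ` (ring_center \<inter> carrier (valuation_ring v))"

definition formally_real :: "('a, 'b) ring_scheme \<Rightarrow> bool" where
  "formally_real R \<longleftrightarrow>
    (\<forall>(n::nat) a. (\<forall>i<n. a i \<in> carrier R) \<longrightarrow>
      (\<Oplus>\<^bsub>R\<^esub>i\<in>{..<n}. a i \<otimes>\<^bsub>R\<^esub> a i) \<noteq> \<ominus>\<^bsub>R\<^esub> \<one>\<^bsub>R\<^esub>)"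

text \<open>The following notions are meant for abelian groups.\<close>

definition divisible_by :: "nat \<Rightarrow> ('a, 'b) monoid_scheme \<Rightarrow> bool" where
  "divisible_by n G \<longleftrightarrow> (\<forall>g \<in> carrier G. \<exists>h \<in> carrier G. h [^]\<^bsub>G\<^esub> n = g)"

text \<open>
  Clearing denominators, linear independence over the rationals in \<open>\<rat> \<otimes> G\<close> is independence over
  the integers in \<open>G\<close>. Finite families are given as lists, so that repeated members count as
  dependent; the rational rank is the supremum of the lengths of independent families, that is
  \<open>dim(\<rat> \<otimes> G)\<close> (with all infinite dimensions identified).
\<close>

definition rationally_independent :: "('a, 'b) monoid_scheme \<Rightarrow> 'a list \<Rightarrow> bool" where
  "rationally_independent G gs \<longleftrightarrow>
    (\<forall>k :: nat \<Rightarrow> int.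
      (\<Otimes>\<^bsub>G\<^esub>i\<in>{..<length gs}. (gs ! i) [^]\<^bsub>G\<^esub> k i) = \<one>\<^bsub>G\<^esub> \<longrightarrow> (\<forall>i<length gs. k i = 0))"

definition rational_rank :: "('a, 'b) monoid_scheme \<Rightarrow> enat" where
  "rational_rank G =
    (SUP gs \<in> {gs. set gs \<subseteq> carrier G \<and> rationally_independent G gs}. enat (length gs))"

definition strongly_abelian ::
    "('d::division_ring \<Rightarrow> 'g::linordered_group_add top) \<Rightarrow> bool" where
  "strongly_abelian v \<longleftrightarrow>
    (\<forall>a b. a \<noteq> 0 \<longrightarrow> b \<noteq> 0 \<longrightarrow> v (a * b - b * a) > v (a * b))"

end

theory Submission
  imports Defs
begin

text \<open>
  Call two elements of \<open>D \<setminus> {0}\<close> equivalent if they agree modulo the normal subgroup \<open>1 + M\<^sub>v\<close>.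
  Since all residues are central, elements of value 0 commute with everything up to equivalence,
  so the commutator of \<open>a\<close> and \<open>b\<close> depends only on \<open>v a\<close> and \<open>v b\<close>, and is multiplicative in
  each argument up to equivalence. By rank 2 some nontrivial power of any \<open>a\<close> has the value of a
  product of powers of \<open>x\<close> and \<open>y\<close>, so every commutator is a root of unity in the residue field.
  By 2-divisibility it is moreover the square \<open>u\<^sup>2\<close> of another one, and
  \<open>1 + u\<^sup>2 + \<dots> + u\<^bsup>2(n-1)\<^esup>\<close> cannot vanish in a formally real field, so the commutator is 1.
\<close>

section \<open>Ordered groups without commutativity\<close>

lemma add_strict_left_mono_group:
  fixes a b c :: "'g::linordered_group_add"
  shows "c + a < c + b \<longleftrightarrow> a < b"
  by (metis add_left_cancel linorder_not_less linordered_group_add_left_mono order_le_less)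

lemma add_strict_right_mono_group:
  fixes a b c :: "'g::linordered_group_add"
  shows "a + c < b + c \<longleftrightarrow> a < b"
  by (metis add_right_cancel linorder_not_less linordered_group_add_right_mono order_le_less)

text \<open>By strict monotonicity, doubling keeps positive elements positive and negative ones
  negative. This is what yields \<open>v (-1) = 0\<close>.\<close>

lemma double_eq_zero_group:
  fixes a :: "'g::linordered_group_add"
  assumes "a + a = 0"
  shows "a = 0"
  using assms add_strict_left_mono_group[of a 0 a] add_strict_left_mono_group[of a a 0]
  by (metis add.right_neutral less_linear order_less_asym)

lemma add_nonneg_group:
  fixes a b :: "'g::linordered_group_add"
  assumes "0 \<le> a" "0 \<le> b"
  shows "0 \<le> a + b"
  using linordered_group_add_left_mono[OF assms(2), of a] assms(1) by simp

section \<open>Elementary properties of valuations\<close>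

locale valued_division_ring =
  fixes v :: "'d::division_ring \<Rightarrow> 'g::linordered_group_add top"
  assumes valuation: "valuation v"
begin

lemma v_Top_iff: "v a = top.Top \<longleftrightarrow> a = 0"
  and v_mult: "v (a * b) = v a + v b"
  and v_add_ge_min: "min (v a) (v b) \<le> v (a + b)"
  using valuation by (auto simp: valuation_def)

lemma v_Value: "a \<noteq> 0 \<Longrightarrow> \<exists>g. v a = top.Value g"
  by (cases "v a") (auto simp: v_Top_iff)

lemma v_mult_less_left: "c \<noteq> 0 \<Longrightarrow> v (c * p) < v (c * q) \<longleftrightarrow> v p < v q"
  using v_Value[of c]
  by (cases "v p"; cases "v q")
     (auto simp: v_mult plus_top_def add_strict_left_mono_group)

lemma v_mult_less_right: "c \<noteq> 0 \<Longrightarrow> v (p * c) < v (q * c) \<longleftrightarrow> v p < v q"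
  using v_Value[of c]
  by (cases "v p"; cases "v q")
     (auto simp: v_mult plus_top_def add_strict_right_mono_group)

lemma v_one: "v 1 = 0"
  using v_Value[of 1] v_mult[of 1 1]
  by (auto simp: plus_top_def zero_top_def) (metis add.right_neutral add_left_imp_eq)

lemma v_minus: "v (- a) = v a"
proof -
  \<comment> \<open>Since \<open>(-1) * (-1) = 1\<close>, the value of \<open>-1\<close> doubles to
    0, and an ordered group has no 2-torsion.\<close>
  have "v (-1) = 0"
    using v_Value[of "-1"] v_mult[of "-1" "-1"]
    by (auto simp: plus_top_def zero_top_def v_one intro: double_eq_zero_group)
  thus ?thesis
    using v_mult[of "-1" a] by simp
qed

lemma v_add_gt: "g < v a \<Longrightarrow> g < v b \<Longrightarrow> g < v (a + b)"
  using v_add_ge_min[of a b] by (meson less_le_trans min_less_iff_conj)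

lemma v_add_ge: "g \<le> v a \<Longrightarrow> g \<le> v b \<Longrightarrow> g \<le> v (a + b)"
  using v_add_ge_min[of a b] by (meson order_trans min.boundedI)

lemma v_inverse_eq: "a \<noteq> 0 \<Longrightarrow> v (inverse a) + v a = 0"
  by (metis left_inverse v_mult v_one)

lemma v_zero_nonzero: "v u = 0 \<Longrightarrow> u \<noteq> 0"
  using v_Top_iff[of u] by (auto simp: zero_top_def)

lemma v_power_zero: "v u = 0 \<Longrightarrow> v (u ^ n) = 0"
  by (induction n) (auto simp: v_one v_mult)

lemma v_mult_nonneg: "0 \<le> v a \<Longrightarrow> 0 \<le> v b \<Longrightarrow> 0 \<le> v (a * b)"
  by (cases "v a"; cases "v b") (auto simp: v_mult plus_top_def zero_top_def add_nonneg_group)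

lemma v_mult_pos:
  assumes "0 < v a" "0 \<le> v b"
  shows "0 < v (a * b)" "0 < v (b * a)"
proof -
  have Top: "(0::'g top) < top.Top" by (simp add: zero_top_def)
  have "0 < v (a * b) \<and> 0 < v (b * a)"
  proof (cases "b = 0")
    case True
    thus ?thesis using v_Top_iff[of 0] Top by simp
  next
    case False
    \<comment> \<open>Multiplication by \<open>b\<close> preserves the strict inequality
      \<open>v 1 < v a\<close> on either side.\<close>
    have "v (1 * b) < v (a * b)" "v (b * 1) < v (b * a)"
      using False assms by (simp_all only: v_mult_less_left v_mult_less_right v_one not_False_eq_True)
    thus ?thesis using assms by (auto intro: le_less_trans)
  qed
  thus "0 < v (a * b)" "0 < v (b * a)" by auto
qed

section \<open>Congruence and commutation modulo \<open>1 + M\<^sub>v\<close>\<close>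

definition equivalent :: "'d \<Rightarrow> 'd \<Rightarrow> bool" (infix \<open>\<sim>\<close> 50)
  where "p \<sim> q \<longleftrightarrow> v p < v (p - q)"

lemma equivalent_v_eq:
  assumes "p \<sim> q"
  shows "v p = v q"
proof -
  have "v p \<le> v (p + (q - p))"
    using assms v_minus[of "p - q"] by (intro v_add_ge) (auto simp: equivalent_def)
  \<comment> \<open>Otherwise \<open>p = q + (p - q)\<close> would be a sum of two elements of value
    above \<open>v p\<close>.\<close>
  moreover have "\<not> v p < v q"
    using v_add_gt[of "v p" q "p - q"] assms by (auto simp: equivalent_def)
  ultimately show ?thesis by simp
qed

text \<open>At 0 reflexivity fails, because nothing exceeds \<open>v 0 = top.Top\<close>. The
  relation thus lives on nonzero elements only.\<close>

lemma equivalent_refl: "p \<noteq> 0 \<Longrightarrow> p \<sim> p"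
  using v_Value[of p] v_Top_iff[of 0] by (auto simp: equivalent_def)

lemma equivalent_sym: "p \<sim> q \<Longrightarrow> q \<sim> p"
  using equivalent_v_eq[of p q] v_minus[of "p - q"] by (auto simp: equivalent_def)

lemma equivalent_trans [trans]: "p \<sim> q \<Longrightarrow> q \<sim> r \<Longrightarrow> p \<sim> r"
  using equivalent_v_eq[of p q] v_add_gt[of "v p" "p - q" "q - r"] by (auto simp: equivalent_def)

lemma equivalent_mult_left: "c \<noteq> 0 \<Longrightarrow> c * p \<sim> c * q \<longleftrightarrow> p \<sim> q"
  by (simp add: equivalent_def v_mult_less_left flip: right_diff_distrib)

lemma equivalent_mult_right: "c \<noteq> 0 \<Longrightarrow> p * c \<sim> q * c \<longleftrightarrow> p \<sim> q"
  by (simp add: equivalent_def v_mult_less_right flip: left_diff_distrib)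

text \<open>Commutation in the quotient of the multiplicative group by \<open>1 + M\<^sub>v\<close>;
  \<open>strongly_abelian v\<close> says that it holds for all nonzero pairs.\<close>

definition commuting :: "'d \<Rightarrow> 'd \<Rightarrow> bool"
  where "commuting a b \<longleftrightarrow> a * b \<sim> b * a"

lemma commuting_sym: "commuting a b \<Longrightarrow> commuting b a"
  by (simp only: commuting_def equivalent_sym)

lemma commuting_refl: "a \<noteq> 0 \<Longrightarrow> commuting a a"
  by (simp add: commuting_def equivalent_refl)

lemma commuting_nonzero: "commuting a b \<Longrightarrow> a \<noteq> 0 \<and> b \<noteq> 0"
  by (auto simp: commuting_def equivalent_def)

text \<open>Move \<open>c\<close> first past \<open>b\<close>, then past \<open>a\<close>. Together
  with closure under inverses, this makes the centralizer of an element modulo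
  \<open>1 + M\<^sub>v\<close> a subgroup.\<close>

lemma commuting_mult:
  assumes "commuting a c" "commuting b c"
  shows "commuting (a * b) c"
proof -
  have "a \<noteq> 0" "b \<noteq> 0" using assms commuting_nonzero by auto
  have "a * (b * c) \<sim> a * (c * b)"
    using assms \<open>a \<noteq> 0\<close> by (simp add: equivalent_mult_left commuting_def)
  also have "a * (c * b) = (a * c) * b" by (simp add: mult.assoc)
  also have "(a * c) * b \<sim> (c * a) * b"
    using assms \<open>b \<noteq> 0\<close> by (simp add: equivalent_mult_right commuting_def)
  finally show ?thesis by (simp add: commuting_def mult.assoc)
qed

text \<open>Multiply \<open>a * b \<sim> b * a\<close> by \<open>inverse a\<close> on both
  sides.\<close>

lemma commuting_inverse:
  assumes "commuting a b"
  shows "commuting (inverse a) b"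
proof -
  have "a \<noteq> 0" using assms commuting_nonzero by auto
  hence "inverse a * ((a * b) * inverse a) \<sim> inverse a * ((b * a) * inverse a)"
    using assms by (simp add: equivalent_mult_left equivalent_mult_right commuting_def)
  moreover have "inverse a * ((a * b) * inverse a) = b * inverse a"
    using \<open>a \<noteq> 0\<close> by (metis left_inverse mult.assoc mult_1)
  moreover have "inverse a * ((b * a) * inverse a) = inverse a * b"
    using \<open>a \<noteq> 0\<close> by (simp add: mult.assoc)
  ultimately show ?thesis by (metis commuting_def equivalent_sym)
qed

lemma commuting_power: "commuting a b \<Longrightarrow> commuting (a ^ n) b"
proof (induction n)
  case 0
  thus ?case using commuting_nonzero[of a b] by (simp add: commuting_def equivalent_refl)
qed (auto simp: commuting_mult)

lemma commuting_powi: "commuting a b \<Longrightarrow> commuting (a powi k) b"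
  by (auto simp: power_int_def commuting_power commuting_inverse)

section \<open>The residue ring and its sums of squares\<close>

lemma valuation_ring_ring: "ring (valuation_ring v)"
proof -
  have 0: "0 \<le> v 0" using v_Top_iff[of 0] by (simp add: zero_top_def)
  show ?thesis
    by (intro ringI abelian_groupI monoidI)
       (auto simp: valuation_ring_def v_one 0 v_mult_nonneg v_add_ge algebra_simps v_minus
          intro!: exI[of _ "- _"])
qed

lemma valuation_ideal_ideal: "ideal (valuation_ideal v) (valuation_ring v)"
proof -
  interpret ring "valuation_ring v" by (rule valuation_ring_ring)
  have 0: "0 < v 0" using v_Top_iff[of 0] by (simp add: zero_top_def)
  \<comment> \<open>The subgroup criterion speaks of the inverse of the additive record, which has
    to be identified with negation in \<open>'d\<close>.\<close>
  have inv: "inv\<^bsub>add_monoid (valuation_ring v)\<^esub> a = - a" if "0 \<le> v a" for a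
    using that by (intro group.inv_equality[OF a_group]) (auto simp: valuation_ring_def v_minus)
  show ?thesis
    by (intro idealI[OF valuation_ring_ring] group.subgroupI[OF a_group])
       (use 0 in \<open>auto simp: valuation_ring_def valuation_ideal_def v_minus v_add_gt v_mult_pos
          inv[unfolded valuation_ring_def, simplified] less_imp_le\<close>)
qed

definition residue :: "'d \<Rightarrow> 'd set"
  where "residue a = valuation_ideal v +>\<^bsub>valuation_ring v\<^esub> a"

lemma residue_ring_hom: "ring_hom_ring (valuation_ring v) (residue_ring v) residue"
  using ideal.rcos_ring_hom_ring[OF valuation_ideal_ideal]
  by (simp add: residue_ring_def residue_def[abs_def])

lemma residue_eq_iff:
  assumes "0 \<le> v a" "0 \<le> v b"
  shows "residue a = residue b \<longleftrightarrow> 0 < v (a - b)"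
proof -
  interpret ring "valuation_ring v" by (rule valuation_ring_ring)
  have carrier: "a \<in> carrier (valuation_ring v)" "b \<in> carrier (valuation_ring v)"
    using assms by (simp_all add: valuation_ring_def)
  have "\<ominus>\<^bsub>valuation_ring v\<^esub> b = - b"
    using assms by (intro minus_equality) (simp_all add: valuation_ring_def v_minus)
  hence "a \<ominus>\<^bsub>valuation_ring v\<^esub> b = a - b"
    by (simp add: a_minus_def) (simp add: valuation_ring_def)
  thus ?thesis
    using quotient_eq_iff_same_a_r_cos[OF valuation_ideal_ideal carrier]
    by (simp add: residue_def valuation_ideal_def)
qed

lemma residue_in_carrier: "0 \<le> v a \<Longrightarrow> residue a \<in> carrier (residue_ring v)"
  by (rule ring_hom_closed[OF ring_hom_ring.homh[OF residue_ring_hom]])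
     (simp add: valuation_ring_def)

text \<open>Carries sums of squares from the quotient record back to \<open>'d\<close>. Both claims
  go through one induction, because additivity of \<open>residue\<close> needs the partial sums to
  lie in the valuation ring.\<close>

lemma residue_sum_squares:
  fixes a :: "nat \<Rightarrow> 'd"
  assumes "\<And>i. i < n \<Longrightarrow> 0 \<le> v (a i)"
  shows "0 \<le> v (\<Sum>i<n. a i * a i)"
    and "(\<Oplus>\<^bsub>residue_ring v\<^esub>i\<in>{..<n}. residue (a i) \<otimes>\<^bsub>residue_ring v\<^esub> residue (a i))
      = residue (\<Sum>i<n. a i * a i)"
proof -
  interpret h: ring_hom_ring "valuation_ring v" "residue_ring v" residue
    by (rule residue_ring_hom)
  have [simp]: "0 \<le> v 0" using v_Top_iff[of 0] by (simp add: zero_top_def)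
  have hom: "residue (p * q) = residue p \<otimes>\<^bsub>residue_ring v\<^esub> residue q"
    "residue (p + q) = residue p \<oplus>\<^bsub>residue_ring v\<^esub> residue q" if "0 \<le> v p" "0 \<le> v q" for p q
    using h.hom_mult[of p q] h.hom_add[of p q] that by (auto simp: valuation_ring_def)
  have "0 \<le> v (\<Sum>i<n. a i * a i) \<and>
    (\<Oplus>\<^bsub>residue_ring v\<^esub>i\<in>{..<n}. residue (a i) \<otimes>\<^bsub>residue_ring v\<^esub> residue (a i))
      = residue (\<Sum>i<n. a i * a i)"
    using assms
  proof (induction n)
    case 0
    show ?case using h.hom_zero by (simp add: valuation_ring_def)
  next
    case (Suc n)
    let ?t = "\<lambda>i. residue (a i) \<otimes>\<^bsub>residue_ring v\<^esub> residue (a i)"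
    have nonneg: "0 \<le> v (a n)" "0 \<le> v (a n * a n)" "0 \<le> v (\<Sum>i<n. a i * a i)"
      using Suc by (simp_all add: v_mult_nonneg)
    have "residue (a i) \<in> carrier (residue_ring v)" if "i < Suc n" for i
      using Suc.prems that by (simp add: residue_in_carrier)
    hence "(\<Oplus>\<^bsub>residue_ring v\<^esub>i\<in>{..<Suc n}. ?t i)
        = ?t n \<oplus>\<^bsub>residue_ring v\<^esub> (\<Oplus>\<^bsub>residue_ring v\<^esub>i\<in>{..<n}. ?t i)"
      unfolding lessThan_Suc by (intro h.S.finsum_insert) (simp_all add: Pi_def)
    also have "\<dots> = residue (a n * a n) \<oplus>\<^bsub>residue_ring v\<^esub> residue (\<Sum>i<n. a i * a i)"
      using Suc hom(1)[of "a n" "a n"] nonneg by simp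
    also have "\<dots> = residue (a n * a n + (\<Sum>i<n. a i * a i))"
      using hom(2) nonneg by metis
    finally show ?case using nonneg by (simp add: v_add_ge add.commute)
  qed
  thus "0 \<le> v (\<Sum>i<n. a i * a i)"
    and "(\<Oplus>\<^bsub>residue_ring v\<^esub>i\<in>{..<n}. residue (a i) \<otimes>\<^bsub>residue_ring v\<^esub> residue (a i))
      = residue (\<Sum>i<n. a i * a i)"
    by auto
qed

text \<open>Formal reality read in \<open>'d\<close>: a positive value would make the residues of
  the \<open>a i\<close> have squares summing to -1.\<close>

lemma formally_real_sum_squares:
  fixes a :: "nat \<Rightarrow> 'd"
  assumes "formally_real (residue_ring v)" and a: "\<And>i. i < n \<Longrightarrow> 0 \<le> v (a i)"
  shows "v (1 + (\<Sum>i<n. a i * a i)) \<le> 0"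
proof (rule ccontr)
  interpret h: ring_hom_ring "valuation_ring v" "residue_ring v" residue
    by (rule residue_ring_hom)
  assume "\<not> ?thesis"
  hence "0 < v ((\<Sum>i<n. a i * a i) - (- 1))" by (simp add: add.commute)
  hence "residue (\<Sum>i<n. a i * a i) = residue (- 1)"
    using residue_sum_squares(1)[OF a] by (subst residue_eq_iff) (auto simp: v_minus v_one)
  moreover have "residue (- 1) = \<ominus>\<^bsub>residue_ring v\<^esub> \<one>\<^bsub>residue_ring v\<^esub>"
  proof -
    have "\<ominus>\<^bsub>valuation_ring v\<^esub> 1 = - 1"
      by (intro h.R.minus_equality) (auto simp: valuation_ring_def v_minus v_one)
    thus ?thesis
      using h.hom_a_inv[of 1] h.hom_one by (simp add: valuation_ring_def v_one)
  qed
  ultimately have "(\<Oplus>\<^bsub>residue_ring v\<^esub>i\<in>{..<n}. residue (a i) \<otimes>\<^bsub>residue_ring v\<^esub> residue (a i))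
      = \<ominus>\<^bsub>residue_ring v\<^esub> \<one>\<^bsub>residue_ring v\<^esub>"
    using residue_sum_squares(2)[OF a] by simp
  thus False
    using assms(1)[unfolded formally_real_def, rule_format, of n "\<lambda>i. residue (a i)"]
      residue_in_carrier a by blast
qed

text \<open>With \<open>w = u ^ 2\<close>, factor \<open>w ^ n - 1 = (w - 1) * s\<close>. If
  \<open>w\<close> is not congruent to 1, then \<open>w - 1\<close> has value 0, so \<open>s\<close>
  has positive value; but \<open>s\<close> is 1 plus a sum of squares. Squares are needed here: -1
  is itself a root of unity.\<close>

lemma square_root_of_unity:
  assumes "formally_real (residue_ring v)" and u: "v u = 0" and "0 < n" and "u ^ (2 * n) \<sim> 1"
  shows "u ^ 2 \<sim> 1"
proof (rule ccontr)
  define s where "s = (\<Sum>i<n. (u ^ 2) ^ i)"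
  obtain m where m: "n = Suc m" using \<open>0 < n\<close> by (cases n) auto
  assume "\<not> ?thesis"
  hence "v (u ^ 2 - 1) \<le> 0"
    using v_power_zero[OF u, of 2] by (simp add: equivalent_def)
  moreover have "0 \<le> v (u ^ 2 - 1)"
    using v_power_zero[OF u, of 2] v_add_ge[of 0 "u ^ 2" "- 1"] by (simp add: v_minus v_one)
  ultimately have "v (u ^ 2 - 1) = 0" by simp
  moreover have "0 < v (u ^ (2 * n) - 1)"
    using assms(4) v_power_zero[OF u, of "2 * n"] by (simp add: equivalent_def)
  moreover have "u ^ (2 * n) - 1 = (u ^ 2 - 1) * s"
  proof -
    have "(w - 1) * (\<Sum>i<k. w ^ i) = w ^ k - 1" for w :: 'd and k
      by (induction k) (auto simp: algebra_simps power_commutes)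
    from this[of "u ^ 2" n] show ?thesis by (simp add: s_def power_mult)
  qed
  ultimately have "0 < v s" by (simp add: v_mult)
  \<comment> \<open>The term of index 0 is the 1; each later power of \<open>u ^ 2\<close> is the
    square of a power of \<open>u\<close>.\<close>
  moreover have "s = 1 + (\<Sum>i<m. u ^ Suc i * u ^ Suc i)"
    unfolding s_def m sum.lessThan_Suc_shift
    by (simp flip: power_mult power_add power_Suc add: mult_2)
  ultimately show False
    using formally_real_sum_squares[OF assms(1), of m "\<lambda>i. u ^ Suc i"] v_power_zero[OF u]
    by (metis leD order_refl)
qed

end

section \<open>Commutators when residues are central and values commute\<close>

locale residually_central = valued_division_ring +
  assumes center_residue: "v u = 0 \<Longrightarrow> \<exists>z\<in>ring_center. 0 < v (u - z)"
    and v_commute: "a \<noteq> 0 \<Longrightarrow> b \<noteq> 0 \<Longrightarrow> v (a * b) = v (b * a)"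
begin

text \<open>Modulo \<open>1 + M\<^sub>v\<close>, an element of value 0 can be replaced by a central
  one.\<close>

lemma commuting_unit:
  assumes "v u = 0" "a \<noteq> 0"
  shows "commuting u a"
proof -
  obtain z where z: "z \<in> ring_center" "u \<sim> z"
    using center_residue assms by (auto simp: equivalent_def)
  have "u * a \<sim> z * a" using z assms by (simp add: equivalent_mult_right)
  also have "z * a = a * z" using z by (simp add: ring_center_def)
  also have "a * z \<sim> a * u" using z assms equivalent_sym[of u z] by (simp add: equivalent_mult_left)
  finally show ?thesis by (simp add: commuting_def)
qed

text \<open>Elements of equal value differ by a factor of value 0, which commutes with everything
  modulo \<open>1 + M\<^sub>v\<close>.\<close>

lemma commuting_v_cong:
  assumes "commuting a b" "v a' = v a"
  shows "commuting a' b"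
proof -
  have nz: "a \<noteq> 0" "b \<noteq> 0" using assms commuting_nonzero by auto
  have "v (inverse a * a') = 0" using assms nz v_inverse_eq[of a] by (simp add: v_mult)
  hence "commuting (inverse a * a') b" using nz by (simp add: commuting_unit)
  hence "commuting (a * (inverse a * a')) b" using assms commuting_mult by blast
  thus ?thesis using nz by (simp flip: mult.assoc)
qed

text \<open>Here \<open>u\<close> represents the commutator of \<open>a\<close> and
  \<open>b\<close>. Moving each factor \<open>a\<close> past \<open>b\<close> produces one
  \<open>u\<close>, and the powers of \<open>u\<close> can be collected on the left because they
  have value 0.\<close>

lemma commutator_power:
  assumes "v u = 0" "a \<noteq> 0" "b \<noteq> 0" "a * b \<sim> u * (b * a)"
  shows "a ^ n * b \<sim> u ^ n * (b * a ^ n)"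
proof (induction n)
  case 0
  show ?case using assms by (simp add: equivalent_refl)
next
  case (Suc n)
  have un: "v (u ^ n) = 0" "u ^ n \<noteq> 0" using assms v_power_zero v_zero_nonzero by auto
  have "a ^ Suc n * b = a * (a ^ n * b)" by (simp add: mult.assoc)
  also have "\<dots> \<sim> a * (u ^ n * (b * a ^ n))"
    using Suc assms by (simp add: equivalent_mult_left)
  also have "\<dots> = (a * u ^ n) * (b * a ^ n)" by (simp add: mult.assoc)
  also have "\<dots> \<sim> (u ^ n * a) * (b * a ^ n)"
    using commuting_sym[OF commuting_unit[OF un(1) \<open>a \<noteq> 0\<close>]] assms
    by (simp add: equivalent_mult_right commuting_def)
  also have "\<dots> = u ^ n * ((a * b) * a ^ n)" by (simp add: mult.assoc)
  also have "\<dots> \<sim> u ^ n * (u * (b * a) * a ^ n)"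
    using assms un by (simp add: equivalent_mult_left equivalent_mult_right)
  also have "\<dots> = u ^ Suc n * (b * a ^ Suc n)"
    by (simp add: mult.assoc power_commutes[symmetric])
  finally show ?case .
qed

text \<open>The element \<open>c\<close> has half the value of \<open>a\<close>, so the commutator
  of \<open>a\<close> and \<open>b\<close> is represented by the square of that of \<open>c\<close>
  and \<open>b\<close>. That square is a root of unity in the residue field, hence 1 by formal
  reality.\<close>

lemma commuting_root:
  assumes "formally_real (residue_ring v)" and "c * c \<noteq> 0" and "v (c * c) = v a"
    and "0 < n" and "commuting (a ^ n) b"
  shows "commuting a b"
proof -
  have nz: "a ^ n \<noteq> 0" "b \<noteq> 0" "c \<noteq> 0" using assms commuting_nonzero[of "a ^ n" b] by auto
  \<comment> \<open>The commutator of \<open>c\<close> and \<open>b\<close>; its value is 0 because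
    values commute.\<close>
  define u where "u = c * b * inverse (b * c)"
  have "v u = v (c * b) + v (inverse (b * c))" unfolding u_def by (rule v_mult)
  also have "\<dots> = v (b * c) + v (inverse (b * c))" using nz v_commute[of c b] by simp
  also have "\<dots> = v (b * c * inverse (b * c))" by (rule v_mult[symmetric])
  finally have u: "v u = 0" using nz by (simp add: v_one)
  have "c * b = u * (b * c)" using nz by (simp add: u_def mult.assoc)
  hence "c * b \<sim> u * (b * c)" using nz equivalent_refl[of "c * b"] v_zero_nonzero[OF u] by simp
  note pow = commutator_power[OF u \<open>c \<noteq> 0\<close> \<open>b \<noteq> 0\<close> this]
  have "v (c ^ (2 * m)) = v (a ^ m)" for m
    by (induction m) (use \<open>v (c * c) = v a\<close> in \<open>simp_all add: v_mult flip: add.assoc\<close>)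
  hence "commuting (c ^ (2 * n)) b" using commuting_v_cong assms by blast
  hence "b * c ^ (2 * n) \<sim> u ^ (2 * n) * (b * c ^ (2 * n))"
    using pow[of "2 * n"] equivalent_sym equivalent_trans unfolding commuting_def by blast
  \<comment> \<open>The factor 1 is inserted so that the common right factor can be
    cancelled.\<close>
  hence "1 * (b * c ^ (2 * n)) \<sim> u ^ (2 * n) * (b * c ^ (2 * n))" by simp
  hence "u ^ (2 * n) \<sim> 1"
    using nz equivalent_sym equivalent_mult_right[of "b * c ^ (2 * n)" 1] by simp
  hence "u ^ 2 \<sim> 1" using square_root_of_unity assms u by blast
  hence "u ^ 2 * (b * c ^ 2) \<sim> 1 * (b * c ^ 2)"
    using nz equivalent_mult_right[of "b * c ^ 2" "u ^ 2" 1] by simp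
  hence "commuting (c ^ 2) b"
    using pow[of 2] equivalent_trans unfolding commuting_def by fastforce
  thus ?thesis using commuting_v_cong assms by (simp add: power2_eq_square)
qed

end

section \<open>Rational dependence of values, expressed by monomials in \<open>'d\<close>\<close>

context valued_division_ring
begin

lemma value_group_nat_pow: "v a [^]\<^bsub>value_group v\<^esub> (n::nat) = v (a ^ n)"
  by (induction n) (simp_all add: value_group_def v_one v_mult power_Suc2 del: power_Suc)

lemma value_group_int_pow:
  assumes "group (value_group v)" "a \<noteq> 0"
  shows "v a [^]\<^bsub>value_group v\<^esub> (k::int) = v (a powi k)"
proof -
  interpret group "value_group v" by fact
  have inv: "inv\<^bsub>value_group v\<^esub> v b = v (inverse b)" if "b \<noteq> 0" for b
    using that v_inverse_eq[of b] by (intro inv_equality) (auto simp: value_group_def)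
  show ?thesis
    using assms by (auto simp: int_pow_def2 power_int_def value_group_nat_pow inv power_inverse)
qed

text \<open>Products in \<open>'d\<close> depend on the order of the factors, so a list fixes it. It
  is reversed because the induction adds each new factor on the left.\<close>

lemma value_group_prod:
  assumes "comm_group (value_group v)" and "\<And>i. i < length as \<Longrightarrow> as ! i \<noteq> 0"
  shows "(\<Otimes>\<^bsub>value_group v\<^esub>i\<in>{..<length as}. (map v as ! i) [^]\<^bsub>value_group v\<^esub> (k i :: int))
    = v (\<Prod>i\<leftarrow>rev [0..<length as]. as ! i powi k i)"
proof -
  interpret comm_group "value_group v" by fact
  have "(\<Otimes>\<^bsub>value_group v\<^esub>i\<in>{..<n}. (map v as ! i) [^]\<^bsub>value_group v\<^esub> (k i :: int))
    = v (\<Prod>i\<leftarrow>rev [0..<n]. as ! i powi k i)" if "n \<le> length as" for n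
    using that
  proof (induction n)
    case 0
    show ?case by simp (simp add: value_group_def v_one)
  next
    case (Suc n)
    have pow: "(map v as ! i) [^]\<^bsub>value_group v\<^esub> k i = v (as ! i powi k i)" if "i < Suc n" for i
      using that Suc.prems assms by (simp add: value_group_int_pow[OF is_group])
    have closed: "v (as ! i powi k i) \<in> carrier (value_group v)" if "i < Suc n" for i
      using that Suc.prems assms by (auto simp: value_group_def)
    have "(\<Otimes>\<^bsub>value_group v\<^esub>i\<in>{..<Suc n}. (map v as ! i) [^]\<^bsub>value_group v\<^esub> (k i :: int))
      = v (as ! n powi k n) \<otimes>\<^bsub>value_group v\<^esub>
        (\<Otimes>\<^bsub>value_group v\<^esub>i\<in>{..<n}. (map v as ! i) [^]\<^bsub>value_group v\<^esub> (k i :: int))"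
      unfolding lessThan_Suc by (subst finprod_insert) (auto simp: pow closed)
    thus ?case using Suc by (simp add: v_mult) (simp add: value_group_def)
  qed
  thus ?thesis by simp
qed

lemma rationally_independent_iff:
  assumes "comm_group (value_group v)" and "\<And>i. i < length as \<Longrightarrow> as ! i \<noteq> 0"
  shows "rationally_independent (value_group v) (map v as) \<longleftrightarrow>
    (\<forall>k :: nat \<Rightarrow> int. v (\<Prod>i\<leftarrow>rev [0..<length as]. as ! i powi k i) = 0
      \<longrightarrow> (\<forall>i<length as. k i = 0))"
proof -
  have "\<one>\<^bsub>value_group v\<^esub> = 0" by (simp add: value_group_def)
  thus ?thesis
    using value_group_prod[OF assms] by (simp add: rationally_independent_def)
qed

text \<open>Three values are dependent in rank 2, and independence of \<open>v x\<close> and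
  \<open>v y\<close> forces the exponent of \<open>a\<close> to be nonzero.\<close>

lemma rank_2_dependence:
  assumes comm: "comm_group (value_group v)" and rank: "rational_rank (value_group v) = 2"
    and ind: "rationally_independent (value_group v) [v x, v y]"
    and nz: "x \<noteq> 0" "y \<noteq> 0" "a \<noteq> 0"
  obtains k i j :: int where "k \<noteq> 0" and "v (a powi k * (y powi j * x powi i)) = 0"
proof -
  have nth3: "i = 0 \<or> i = 1 \<or> i = 2" if "i < 3" for i :: nat using that by auto
  have "\<not> rationally_independent (value_group v) (map v [x, y, a])"
  proof
    assume "rationally_independent (value_group v) (map v [x, y, a])"
    hence "enat (length (map v [x, y, a])) \<le> rational_rank (value_group v)"
      unfolding rational_rank_def using nz by (intro SUP_upper) (auto simp: value_group_def)
    thus False by (simp add: rank numeral_eq_enat)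
  qed
  moreover have nz3: "[x, y, a] ! i \<noteq> 0" if "i < length [x, y, a]" for i
    using nz nth3[of i] that by auto
  ultimately obtain k :: "nat \<Rightarrow> int" and l where
    k: "v (a powi k 2 * (y powi k 1 * x powi k 0)) = 0" and l: "l < 3" "k l \<noteq> 0"
    using rationally_independent_iff[OF comm, of "[x, y, a]"]
    by (auto simp: numeral_3_eq_3 numeral_2_eq_2)
  have nz2: "[x, y] ! i \<noteq> 0" if "i < length [x, y]" for i
    using nz that by (auto simp: less_Suc_eq)
  have ind2: "k 0 = 0 \<and> k 1 = 0" if "v (y powi k 1 * x powi k 0) = 0" for k :: "nat \<Rightarrow> int"
    using rationally_independent_iff[OF comm nz2] ind that
    by (auto simp: less_Suc_eq)
  \<comment> \<open>If \<open>k 2\<close> vanished, the relation would involve only \<open>x\<close>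
    and \<open>y\<close>, so all exponents would vanish, contrary to
    \<open>k l \<noteq> 0\<close>.\<close>
  have "k 2 \<noteq> 0"
    using ind2[of k] k l nth3[of l] by auto
  thus ?thesis using that k by blast
qed

end

theorem proposition2p7:
  fixes v :: "'d::division_ring \<Rightarrow> 'g::linordered_group_add top"
    and x y :: 'd
  assumes "valuation v"
    and "carrier (residue_ring v) = residue_of_center v"
    and "comm_group (value_group v)"
    and "divisible_by 2 (value_group v)"
    and "formally_real (residue_ring v)"
    and "rational_rank (value_group v) = 2"
    and "x \<noteq> 0" and "y \<noteq> 0"
    and "rationally_independent (value_group v) [v x, v y]"
    and "v (x * y - y * x) > v (x * y)"
  shows "strongly_abelian v"
proof -
  interpret valued_division_ring v by unfold_locales fact
  interpret residually_central v
  proof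
    fix u assume u: "v u = 0"
    \<comment> \<open>Every residue comes from the center, so \<open>u\<close> has the residue of
      some central \<open>z\<close>.\<close>
    hence "residue u \<in> residue_of_center v"
      using residue_in_carrier[of u] assms(2) by simp
    then obtain z where "z \<in> ring_center" "0 \<le> v z" "residue u = residue z"
      by (auto simp: residue_of_center_def residue_def valuation_ring_def)
    thus "\<exists>z\<in>ring_center. 0 < v (u - z)" using u residue_eq_iff by auto
  next
    fix a b :: 'd assume "a \<noteq> 0" "b \<noteq> 0"
    thus "v (a * b) = v (b * a)"
      using comm_monoid.m_comm[OF comm_group.axioms(1)[OF assms(3)], of "v a" "v b"]
      by (simp add: value_group_def v_mult)
  qed
  \<comment> \<open>2-divisibility supplies the \<open>c\<close> of half the value that
    \<open>commuting_root\<close> requires; a negative exponent is turned positive by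
    inverting.\<close>
  have root: "commuting a b" if "commuting (a powi k) b" "k \<noteq> 0" "a \<noteq> 0" for a b and k :: int
  proof -
    have "v a \<in> carrier (value_group v)" using that by (simp add: value_group_def)
    then obtain h where h: "h \<in> carrier (value_group v)" "h [^]\<^bsub>value_group v\<^esub> (2::nat) = v a"
      using assms(4) unfolding divisible_by_def by blast
    from h(1) obtain c where "c \<noteq> 0" "h = v c" by (auto simp: value_group_def)
    hence c: "c \<noteq> 0" "v (c * c) = v a"
      using h(2) value_group_nat_pow[of c 2] by (simp_all add: power2_eq_square)
    have "commuting (a ^ nat \<bar>k\<bar>) b"
      using that(1) commuting_inverse[OF that(1)]
      by (cases "k \<ge> 0") (auto simp: power_int_def power_inverse)
    thus ?thesis
      using c \<open>k \<noteq> 0\<close> by (intro commuting_root[OF assms(5), of c a "nat \<bar>k\<bar>"]) auto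
  qed
  \<comment> \<open>A centralizer containing \<open>x\<close> and \<open>y\<close> contains every
    monomial \<open>?w\<close> in them and every element of value 0, hence a nontrivial power of
    \<open>b\<close>, and by \<open>root\<close> also \<open>b\<close>.\<close>
  have span: "commuting b a" if "commuting x a" "commuting y a" "b \<noteq> 0" for a b
  proof -
    obtain k i j where k: "k \<noteq> 0" and unit: "v (b powi k * (y powi j * x powi i)) = 0"
      using rank_2_dependence[OF assms(3,6,9,7,8) \<open>b \<noteq> 0\<close>] by blast
    let ?w = "y powi j * x powi i"
    have "?w \<noteq> 0" using assms(7,8) by simp
    have "commuting ?w a" using that by (intro commuting_mult commuting_powi)
    moreover have "commuting (b powi k * ?w) a"
      using unit that commuting_nonzero commuting_unit by blast
    ultimately have "commuting (b powi k * ?w * inverse ?w) a"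
      using commuting_mult commuting_inverse by blast
    moreover have "b powi k * ?w * inverse ?w = b powi k"
      using \<open>?w \<noteq> 0\<close> by (metis mult.assoc mult.right_neutral right_inverse)
    ultimately show ?thesis using root k that by simp
  qed
  have xy: "commuting x y" using assms(10) by (simp add: commuting_def equivalent_def)
  \<comment> \<open>First use of \<open>span\<close>: \<open>x\<close> and \<open>y\<close> commute
    with each other and with themselves, so everything nonzero commutes with both. A second use then
    treats arbitrary pairs.\<close>
  have "commuting x a" "commuting y a" if "a \<noteq> 0" for a
    using that span[of x a] span[of y a] xy commuting_refl commuting_sym assms(7,8) by auto
  hence "commuting a b" if "a \<noteq> 0" "b \<noteq> 0" for a b
    using that span by blast
  thus ?thesis by (auto simp: strongly_abelian_def commuting_def equivalent_def)
qed

end
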